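(* Let $b$ be a nonzero integer such that $p^2+bq^2$ is irreducible over $\mathbb{Q}$ (i.e. $-b$ is not a square in $\mathbb{Q}$). Let $s\in\mathbb{Q}$ with $s\neq0,\pm1$, and let $p_0,q_0,r_0\in\mathbb{Q}$ with $r_0\neq0$ satisfy $$p_0^2+bq_0^2=\frac{(s^2+1)(s^2+2s-1)}{4s^2}\,r_0^2 .$$ Define $$g_1(u)=\big((1-s^2)p_0^2+2sbq_0^2\big)+2(1-2s-s^2)bp_0q_0u+b\big(2sp_0^2+(1-s^2)bq_0^2\big)u^2,$$ $$g_2(u)=2(1-s^2)^2p_0^2+(1+s^2)^2bq_0^2+2(1-6s^2+s^4)bp_0q_0u+b\big((1+s^2)^2p_0^2+2(1-s^2)^2bq_0^2\big)u^2 .$$ Suppose that the set of rational points $(u,w)\in\mathbb{Q}^2$ on the curve $$\mathcal{C}_3:\; w^2=-bs\,g_1(u)g_2(u)$$ is infinite. Then the set of rational points on the surface $$V_3:\;(p^2+bq^2)^2=X^4+\frac{r_0^2(s^2-1)(s^4+2s^3+2s^2-2s+1)}{4s^3}X^2+r_0^4\frac{(s^2-1)^4}{16s^4}$$ is infinite too, in the sense that the set of $X$-coordinates of points $(p,q,X)\in V_3(\mathbb{Q})$ is infinite.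
   Context: $V_3(\mathbb{Q})$ is the set of rational solutions $(p,q,X)\in\mathbb{Q}^3$ of the displayed equation. Convention: "the set of rational points on the surface is infinite" means that its image under the projection $(p,q,X)\mapsto X$ is infinite. *)

theory Defs
  imports Complex_Main "HOL-Computational_Algebra.Polynomial_Factorial"
begin

text \<open>
  The binary form $p^2 + b q^2$ as an element of $\mathbb{Q}[p][q]$: the inner (coefficient)
  variable is $p$, the outer variable is $q$.
\<close>

definition norm_form :: "rat \<Rightarrow> rat poly poly" where
  "norm_form b = [: [:0, 0, 1:], 0, [:b:] :]"

lemma norm_form_irreducible_iff:
  assumes "b \<noteq> 0"
  shows "irreducible (norm_form b) \<longleftrightarrow> \<not> (\<exists>t. t ^ 2 = - b)"
proof
  assume irr: "irreducible (norm_form b)"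
  show "\<not> (\<exists>t. t ^ 2 = - b)"
  proof
    assume "\<exists>t. t ^ 2 = - b"
    then obtain t where t: "t ^ 2 = - b" ..
    then have t0: "t \<noteq> 0" and tb: "b = - (t * t)"
      using assms by (auto simp: power2_eq_square)
    have "norm_form b = [: [:0, 1:], [:t:] :] * [: [:0, 1:], [:- t:] :]"
      by (simp add: norm_form_def tb)
    with irr have "[: [:0, 1:], [:t:] :] dvd (1 :: rat poly poly) \<or>
        [: [:0, 1:], [:- t:] :] dvd (1 :: rat poly poly)"
      by (rule irreducibleD)
    with t0 show False
      by (auto simp: is_unit_poly_iff)
  qed
next
  assume nsq: "\<not> (\<exists>t. t ^ 2 = - b)"
  have unit: "[:c:] dvd 1" if "c dvd 1" for c :: "rat poly"
    using that by (simp add: is_unit_const_poly_iff)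
  have nf: "norm_form b \<noteq> 0" and deg: "degree (norm_form b) = 2"
    and lc: "lead_coeff (norm_form b) = [:b:]"
    using assms by (auto simp: norm_form_def)
  have bu: "[:b:] dvd (1 :: rat poly)"
    using assms by (simp add: is_unit_const_poly_iff dvd_field_iff)
  show "irreducible (norm_form b)"
  proof (rule irreducibleI)
    show "norm_form b \<noteq> 0" by (fact nf)
    show "\<not> norm_form b dvd 1"
      using deg by (auto simp: is_unit_poly_iff)
  next
    fix f g assume eq: "norm_form b = f * g"
    have fg0: "f \<noteq> 0" "g \<noteq> 0" using eq nf by auto
    have d: "degree f + degree g = 2"
      using deg eq fg0 by (simp add: degree_mult_eq)
    have l: "lead_coeff f * lead_coeff g = [:b:]"
      using lc eq by (simp add: lead_coeff_mult)
    have u: "lead_coeff f dvd 1" "lead_coeff g dvd 1"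
      using bu by (simp_all add: l[symmetric] is_unit_mult_iff)
    consider "degree f = 0" | "degree g = 0" | "degree f = 1" "degree g = 1"
      using d by linarith
    then show "f dvd 1 \<or> g dvd 1"
    proof cases
      case 1
      then obtain c where "f = [:c:]" by (rule degree_eq_zeroE)
      with u unit show ?thesis by auto
    next
      case 2
      then obtain c where "g = [:c:]" by (rule degree_eq_zeroE)
      with u unit show ?thesis by auto
    next
      case 3
      from 3(1) obtain f0 f1 where f: "f = [:f0, f1:]"
        by (rule degree1_coeffs)
      from 3(2) obtain g0 g1 where g: "g = [:g0, g1:]"
        by (rule degree1_coeffs)
      have e: "f0 * g0 = [:0, 0, 1:]" "f0 * g1 + f1 * g0 = 0" "f1 * g1 = [:b:]"
        using eq unfolding f g norm_form_def by (auto simp: algebra_simps)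
      define a0 a1 c0 c1 where
        "a0 = poly f0 1" and "a1 = poly f1 1" and "c0 = poly g0 1" and "c1 = poly g1 1"
      have 1: "a0 * c0 = 1" "a0 * c1 + a1 * c0 = 0" "a1 * c1 = b"
        using arg_cong[OF e(1), of "\<lambda>p. poly p 1"] arg_cong[OF e(2), of "\<lambda>p. poly p 1"]
          arg_cong[OF e(3), of "\<lambda>p. poly p 1"]
        by (simp_all add: a0_def a1_def c0_def c1_def)
      have "a1 * c0 = - (a0 * c1)"
        using 1(2) by linarith
      then have "(a1 * c0) ^ 2 = (a1 * c0) * (- (a0 * c1))"
        by (simp add: power2_eq_square)
      also have "\<dots> = - ((a0 * c0) * (a1 * c1))" by (simp add: algebra_simps)
      also have "\<dots> = - b" using 1 by simp
      finally show ?thesis using nsq by blast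
    qed
  qed
qed

definition g1 :: "rat \<Rightarrow> rat \<Rightarrow> rat \<Rightarrow> rat \<Rightarrow> rat \<Rightarrow> rat" where
  "g1 b s p0 q0 u =
     ((1 - s^2) * p0^2 + 2 * s * b * q0^2)
     + 2 * (1 - 2 * s - s^2) * b * p0 * q0 * u
     + b * (2 * s * p0^2 + (1 - s^2) * b * q0^2) * u^2"

definition g2 :: "rat \<Rightarrow> rat \<Rightarrow> rat \<Rightarrow> rat \<Rightarrow> rat \<Rightarrow> rat" where
  "g2 b s p0 q0 u =
     2 * (1 - s^2)^2 * p0^2 + (1 + s^2)^2 * b * q0^2
     + 2 * (1 - 6 * s^2 + s^4) * b * p0 * q0 * u
     + b * ((1 + s^2)^2 * p0^2 + 2 * (1 - s^2)^2 * b * q0^2) * u^2"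

definition C3 :: "rat \<Rightarrow> rat \<Rightarrow> rat \<Rightarrow> rat \<Rightarrow> (rat \<times> rat) set" where
  "C3 b s p0 q0 = {(u, w). w^2 = - b * s * g1 b s p0 q0 u * g2 b s p0 q0 u}"

definition V3 :: "rat \<Rightarrow> rat \<Rightarrow> rat \<Rightarrow> (rat \<times> rat \<times> rat) set" where
  "V3 b s r0 = {(p, q, X).
     (p^2 + b * q^2)^2 =
       X^4
       + r0^2 * (s^2 - 1) * (s^4 + 2 * s^3 + 2 * s^2 - 2 * s + 1) / (4 * s^3) * X^2
       + r0^4 * ((s^2 - 1)^4 / (16 * s^4))}"

end

theory Submission
  imports Defs
begin

text \<open>
  On $V_3$ put $X = r_0 \frac{s^2-1}{2s}\,\xi$ and $p^2+bq^2 = r_0^2 \frac{(s^2-1)^2}{4s^2}\,\nu$.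
  The equation becomes the genus one curve
  $J:\ \nu^2 = \xi^4 + (2-4a)\xi^2 + 1$ with $a = -\frac{(s^2+1)^2}{4s(s^2-1)}$,
  and infinitely many of its rational points must have a $\nu$ that is a norm from
  $\mathbb{Q}(\theta)$, $\theta^2=-b$.

  The curve $J$ has the unramified double covers
  $E_t:\ t x^2 + \frac{a}{t} y^2 = 1 + x^2y^2$, mapped to $J$ by $\xi = xy$,
  $\nu = \pm(t x^2 - \frac{a}{t}y^2)$ (\<open>edwards_jacobi_quartic\<close>). Each $E_t$ is the Edwards curve
  $E_1$ with $x$ and $y$ replaced by $x\sqrt t$ and $y/\sqrt t$, so the Edwards addition law adds a
  point of $E_{t_1}$ and a point of $E_{t_2}$ to a rational point of $E_{t_1t_2}$
  (\<open>edwards_add\<close>). Three of these curves matter: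

  \<^item> $t_1=-b/2$: in the coordinates $P = p_0+bq_0u$, $Q = q_0-p_0u$, the forms $g_1$ and $g_2$
    become diagonal and $\mathcal{C}_3$ turns into $E_{t_1}$
    (\<open>C3_point_gives_edwards_point\<close>).
  \<^item> $t_2=\frac{s^2+1}{s(s+1)}$: it contains the rational point
    $(\frac{s}{s-1},\frac{2}{s+1})$, which lies over the value $X=r_0$ of the given point
    $(p_0,q_0,r_0)$ of $V_3$.
  \<^item> $t_3=t_1t_2$: here $(1+bx^2)(1+y^2/b)$, the norm of $(1+x\theta)(1+y\theta/b)$, is a
    constant multiple of $t_3x^2-\frac{a}{t_3}y^2$, and the constant is such that
    $\nu = -(t_3x^2-\frac{a}{t_3}y^2)$ is a norm times a rational square times $p_0^2+bq_0^2$,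
    itself a norm. So every rational point of $E_{t_3}$ yields a rational point of $V_3$
    (\<open>edwards_point_gives_V3_point\<close>).

  Adding the fixed point of $E_{t_2}$ thus carries the points of $\mathcal{C}_3$ to points of
  $V_3$. Only finitely many of them can share an $X$-coordinate
  (\<open>infinite_edwards_translate\<close>); its hypotheses $a\neq1$ and
  $(x_2y_2)^2\neq1$ hold because their failure would make $2$ a rational square.
\<close>

section \<open>Edwards curves and their twists\<close>

definition edwards :: "'a::field \<Rightarrow> 'a \<Rightarrow> 'a \<Rightarrow> 'a \<Rightarrow> bool" where
  "edwards a t x y \<longleftrightarrow> t * x^2 + a / t * y^2 = 1 + x^2 * y^2"

text \<open>
  Over a field containing $\sqrt{t_1}$ and $\sqrt{t_2}$ this is the usual Edwards addition law
  for the points $(\sqrt{t_i}\,x_i,\ y_i/\sqrt{t_i})$ with $\sqrt{t_1t_2}$ cleared from the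
  result. The proof separates the sum and the difference of the two terms on the left-hand side of
  the target equation: both factor over the two points, and the identity collapses to one in
  $A_i=(x_iy_i)^2$.
\<close>

lemma edwards_add:
  fixes a t1 t2 x1 y1 x2 y2 :: "'a::field"
  assumes "edwards a t1 x1 y1" and "edwards a t2 x2 y2"
    and t: "t1 \<noteq> 0" "t2 \<noteq> 0"
    and "x1 * y1 * (x2 * y2) \<noteq> 1" and "x1 * y1 * (x2 * y2) \<noteq> - 1"
  shows "edwards a (t1 * t2)
    ((x1 * x2 - a / (t1 * t2) * (y1 * y2)) / (1 - x1 * y1 * (x2 * y2)))
    ((t2 * x2 * y1 + t1 * x1 * y2) / (1 + x1 * y1 * (x2 * y2)))"
proof -
  define e where "e = x1 * y1 * (x2 * y2)"
  define A1 A2 where "A1 = (x1 * y1)^2" and "A2 = (x2 * y2)^2"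
  define P Q where "P = x1 * x2 - a / (t1 * t2) * (y1 * y2)"
    and "Q = t2 * x2 * y1 + t1 * x1 * y2"
  define D1 D2 where "D1 = t1 * x1^2 - a / t1 * y1^2" and "D2 = t2 * x2^2 - a / t2 * y2^2"
  have S1: "t1 * x1^2 + a / t1 * y1^2 = 1 + A1" and S2: "t2 * x2^2 + a / t2 * y2^2 = 1 + A2"
    using assms(1,2) by (simp_all add: edwards_def A1_def A2_def power_mult_distrib)
  have e2: "e^2 = A1 * A2"
    by (simp add: e_def A1_def A2_def power_mult_distrib)
  have plus: "t1 * t2 * P^2 + a / (t1 * t2) * Q^2 = (1 + A1) * (1 + A2)"
    unfolding S1[symmetric] S2[symmetric] P_def Q_def using t
    by (simp add: field_simps power2_eq_square)
  have minus: "t1 * t2 * P^2 - a / (t1 * t2) * Q^2 = D1 * D2 - 4 * a * e"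
    unfolding D1_def D2_def P_def Q_def e_def using t
    by (simp add: field_simps power2_eq_square)
  have PQ: "P * Q = x1 * y1 * D2 + x2 * y2 * D1"
    unfolding D1_def D2_def P_def Q_def using t
    by (simp add: field_simps power2_eq_square)
  have D1: "D1^2 = (1 + A1)^2 - 4 * a * A1"
    unfolding S1[symmetric] unfolding D1_def A1_def using t
    by (simp add: field_simps power2_eq_square)
  have D2: "D2^2 = (1 + A2)^2 - 4 * a * A2"
    unfolding S2[symmetric] unfolding D2_def A2_def using t
    by (simp add: field_simps power2_eq_square)
  have "t1 * t2 * P^2 * (1 + e)^2 + a / (t1 * t2) * Q^2 * (1 - e)^2
      = (1 + e^2) * (t1 * t2 * P^2 + a / (t1 * t2) * Q^2)
        + 2 * e * (t1 * t2 * P^2 - a / (t1 * t2) * Q^2)"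
    by (simp add: algebra_simps power2_eq_square)
  also have "\<dots> = (1 + A1 * A2) * ((1 + A1) * (1 + A2)) + 2 * e * (D1 * D2) - 8 * a * e^2"
    unfolding plus minus e2[symmetric] by (simp add: algebra_simps power2_eq_square)
  also have "\<dots> = (1 - A1 * A2)^2 + A1 * D2^2 + A2 * D1^2 + 2 * e * (D1 * D2)"
    unfolding D1 D2 e2 by (simp add: algebra_simps power2_eq_square)
  also have "\<dots> = (1 - e^2)^2 + (P * Q)^2"
    unfolding PQ e2 by (simp add: A1_def A2_def e_def algebra_simps power2_eq_square)
  finally have main: "t1 * t2 * P^2 * (1 + e)^2 + a / (t1 * t2) * Q^2 * (1 - e)^2
      = (1 - e)^2 * (1 + e)^2 + P^2 * Q^2"
    by (simp add: algebra_simps power2_eq_square)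
  have ne: "1 - e \<noteq> 0" "1 + e \<noteq> 0"
    using assms(5,6) by (auto simp: e_def add_eq_0_iff)
  have "t1 * t2 * (P / (1 - e))^2 + a / (t1 * t2) * (Q / (1 + e))^2
      = (t1 * t2 * P^2 * (1 + e)^2 + a / (t1 * t2) * Q^2 * (1 - e)^2) / ((1 - e)^2 * (1 + e)^2)"
    using ne t by (simp add: power_divide add_divide_distrib)
  also have "\<dots> = 1 + (P / (1 - e))^2 * (Q / (1 + e))^2"
    unfolding main using ne by (simp add: power_divide add_divide_distrib)
  finally show ?thesis
    unfolding edwards_def P_def Q_def e_def .
qed

text \<open>
  The functions $xy$ and $tx^2-\frac at y^2$ are invariant under $(x,y)\mapsto(-x,-y)$; they
  describe the quotient of the curve by this translation of order two.
\<close>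

lemma edwards_jacobi_quartic:
  fixes a t x y :: "'a::field"
  assumes "edwards a t x y" and "t \<noteq> 0"
  shows "(t * x^2 - a / t * y^2)^2 = (x * y)^4 + (2 - 4 * a) * (x * y)^2 + 1"
proof -
  have "(t * x^2 - a / t * y^2)^2 = (t * x^2 + a / t * y^2)^2 - 4 * a * (x * y)^2"
    using assms(2) by (simp add: field_simps power2_eq_square)
  also have "\<dots> = (1 + (x * y)^2)^2 - 4 * a * (x * y)^2"
    using assms(1) by (simp add: edwards_def power_mult_distrib)
  finally show ?thesis
    by (simp add: algebra_simps power2_eq_square power4_eq_xxxx)
qed

section \<open>Translation by a point has finite fibres\<close>

lemma finite_square_roots: "finite {y. y^2 = (t::'a::idom)}"
  using poly_roots_finite[of "[:- t, 0, 1:]"] by (simp add: power2_eq_square)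

lemma finite_square_roots_of_poly_roots:
  fixes p :: "'a::idom poly"
  assumes "poly p c \<noteq> 0"
  shows "finite {y. poly p (y^2) = 0}"
proof -
  have "finite {t. poly p t = 0}"
    using assms by (intro poly_roots_finite) auto
  then have "finite (\<Union>t\<in>{t. poly p t = 0}. {y. y^2 = t})"
    by (simp add: finite_square_roots)
  then show ?thesis
    by (rule rev_finite_subset) auto
qed

text \<open>
  The equation in the set says that the sum of $(x,y)$ and $(x_2,y_2)$ has $v$ as the product of its
  coordinates. On $E_{t_1}$ the square $x^2$ is the fraction num/den of linear polynomials in
  $T=y^2$, so the equation reads $N\,xy = R(T)/\mathrm{den}(T)$; squaring leaves a polynomial
  equation $p(T)=0$. It is not trivial: at the root of den and at the root of num only the square of
  $R$ survives, and $R$ cannot vanish at both, since this would need $vr=-1$ and $v=-r$ for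
  $r=x_2y_2$, hence $r^2=1$.
\<close>

lemma edwards_add_xy_fibre:
  fixes a t1 t2 x2 y2 v :: "'a::field"
  assumes a: "a \<noteq> 0" "a \<noteq> 1" and t: "t1 \<noteq> 0" "t2 \<noteq> 0"
    and r: "x2 * y2 \<noteq> 0" "(x2 * y2)^2 \<noteq> 1"
  shows "finite {y. \<exists>x. edwards a t1 x y \<and>
    (x * x2 - a / (t1 * t2) * (y * y2)) * (t2 * x2 * y + t1 * x * y2)
      = v * (1 - (x * y * (x2 * y2))^2)}"
    (is "finite ?S")
proof -
  define r where "r = x2 * y2"
  define N where "N = t2 * x2^2 - a / t2 * y2^2"
  define num den T where "num = [:1, - (a / t1):]" and "den = [:t1, - 1:]" and "T = [:0, 1 :: 'a:]"
  define R where "R = smult v (den - smult (r^2) (num * T))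
      - smult (t1 * r) num + smult (a / t1 * r) (T * den)"
  define p where "p = smult (N^2) (T * num * den) - R^2"
  have shift: "A = D - B + C" if "A + B - C = D" for A B C D :: 'a
    using that by (auto simp: algebra_simps)
  have "poly p (y^2) = 0" if "y \<in> ?S" for y
  proof -
    from that obtain x where E: "edwards a t1 x y"
      and X: "(x * x2 - a / (t1 * t2) * (y * y2)) * (t2 * x2 * y + t1 * x * y2)
        = v * (1 - (x * y * r)^2)"
      by (auto simp: r_def)
    have num: "poly num (y^2) = x^2 * poly den (y^2)"
      using E by (simp add: edwards_def num_def den_def algebra_simps)
    have sum: "(x * x2 - a / (t1 * t2) * (y * y2)) * (t2 * x2 * y + t1 * x * y2)
        = N * (x * y) + t1 * r * x^2 - a / t1 * r * y^2"
      unfolding N_def r_def using t by (simp add: field_simps power2_eq_square)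
    have "N * (x * y) = v * (1 - (x * y * r)^2) - t1 * r * x^2 + a / t1 * r * y^2"
      by (rule shift) (rule trans[OF sum[symmetric] X])
    then have "N * (x * y) * poly den (y^2)
        = (v * (1 - (x * y * r)^2) - t1 * r * x^2 + a / t1 * r * y^2) * poly den (y^2)"
      by simp
    also have "\<dots> = poly R (y^2)"
      by (simp add: R_def T_def num) (simp add: algebra_simps power2_eq_square)
    finally have "(poly R (y^2))^2 = (N * (x * y) * poly den (y^2))^2"
      by simp
    also have "\<dots> = N^2 * (y^2 * (x^2 * poly den (y^2)) * poly den (y^2))"
      by (simp only: power_mult_distrib) (simp add: power2_eq_square mult_ac)
    finally have "(poly R (y^2))^2 = N^2 * (y^2 * (x^2 * poly den (y^2)) * poly den (y^2))" .
    then show ?thesis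
      by (simp add: p_def T_def num)
  qed
  then have sub: "?S \<subseteq> {y. poly p (y^2) = 0}" by blast
  have "\<exists>c. poly p c \<noteq> 0"
  proof (cases "v * r = - 1")
    case False
    \<comment> \<open>\<open>t1\<close> is the root of \<open>den\<close>.\<close>
    have "poly p t1 = - (((1 - a) * (t1 * r) * (v * r + 1))^2)"
    proof -
      have "poly num t1 = 1 - a" "poly den t1 = 0" using t by (simp_all add: num_def den_def)
      then have "poly p t1 = - ((- (v * (r^2 * (t1 * (1 - a)))) - t1 * r * (1 - a))^2)"
        by (simp add: p_def R_def T_def mult.left_commute)
      also have "- (v * (r^2 * (t1 * (1 - a)))) - t1 * r * (1 - a)
          = - ((1 - a) * (t1 * r) * (v * r + 1))"
        by (simp add: algebra_simps power2_eq_square)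
      finally show ?thesis by simp
    qed
    moreover have "v * r + 1 \<noteq> 0" using False by (simp add: add_eq_0_iff2)
    ultimately have "poly p t1 \<noteq> 0" using a t r by (simp add: r_def)
    then show ?thesis ..
  next
    case True
    have "poly num (t1 / a) = 0" using a t by (simp add: num_def)
    then have "poly p (t1 / a) = - ((poly den (t1 / a) * (v + r))^2)"
      using a t by (simp add: p_def R_def T_def algebra_simps)
    moreover have "poly den (t1 / a) \<noteq> 0" using a t by (simp add: den_def field_simps)
    moreover have "v + r \<noteq> 0"
    proof
      assume "v + r = 0"
      then have "v = - r" by (simp add: add_eq_0_iff2)
      with True have "r^2 = 1" by (simp add: power2_eq_square)
      with r show False by (simp add: r_def)
    qed
    ultimately have "poly p (t1 / a) \<noteq> 0" by simp
    then show ?thesis ..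
  qed
  then obtain c where "poly p c \<noteq> 0" ..
  from finite_square_roots_of_poly_roots[OF this] sub show ?thesis
    by (rule rev_finite_subset)
qed

text \<open>
  Addition of a fixed point is injective, but the coordinate product $xy$ of the sum is not. A value
  of this product still leaves finitely many $y$, so infinitely many $y$ produce infinitely many
  products.
\<close>

lemma infinite_edwards_translate:
  fixes a t1 t2 x2 y2 :: "'a::field"
  assumes a: "a \<noteq> 0" "a \<noteq> 1" and t: "t1 \<noteq> 0" "t2 \<noteq> 0"
    and E2: "edwards a t2 x2 y2"
    and r: "x2 * y2 \<noteq> 0" "(x2 * y2)^2 \<noteq> 1"
    and inf: "infinite {y. \<exists>x. edwards a t1 x y}"
  shows "infinite {x * y | x y. edwards a (t1 * t2) x y}" (is "infinite ?V")
proof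
  assume fin: "finite ?V"
  define bad where "bad = {y. \<exists>x. edwards a t1 x y \<and> (x * y * (x2 * y2))^2 = 1}"
  define fib where "fib v = {y. \<exists>x. edwards a t1 x y \<and>
    (x * x2 - a / (t1 * t2) * (y * y2)) * (t2 * x2 * y + t1 * x * y2)
      = v * (1 - (x * y * (x2 * y2))^2)}" for v
  \<comment> \<open>The addition law has a zero denominator only on \<open>bad\<close>; as \<open>t1 \<noteq> 0\<close>, this is a proper
    algebraic condition on \<open>y\<close>.\<close>
  have "finite bad"
  proof -
    define p where "p = smult ((x2 * y2)^2) ([:0, 1:] * [:1, - (a / t1):]) - [:t1, - 1:]"
    have "poly p (y^2) = 0" if "y \<in> bad" for y
    proof -
      from that obtain x where E: "edwards a t1 x y" and 1: "(x * y * (x2 * y2))^2 = 1"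
        by (auto simp: bad_def)
      have num: "1 - a / t1 * y^2 = x^2 * (t1 - y^2)"
        using E by (simp add: edwards_def algebra_simps)
      have "poly p (y^2) = (x2 * y2)^2 * (y^2 * (1 - a / t1 * y^2)) - (t1 - y^2)"
        by (simp add: p_def algebra_simps)
      also have "\<dots> = ((x * y * (x2 * y2))^2 - 1) * (t1 - y^2)"
        unfolding num by (simp add: algebra_simps power2_eq_square)
      finally show ?thesis by (simp add: 1)
    qed
    then have "bad \<subseteq> {y. poly p (y^2) = 0}" by blast
    moreover have "poly p 0 \<noteq> 0" using t by (simp add: p_def)
    ultimately show ?thesis
      using finite_square_roots_of_poly_roots finite_subset by blast
  qed
  moreover have "finite (\<Union>v\<in>?V. fib v)"
    unfolding fib_def using fin edwards_add_xy_fibre[OF a t r] by (intro finite_UN_I) auto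
  moreover have "{y. \<exists>x. edwards a t1 x y} \<subseteq> bad \<union> (\<Union>v\<in>?V. fib v)"
  proof
    fix y assume "y \<in> {y. \<exists>x. edwards a t1 x y}"
    then obtain x where E: "edwards a t1 x y" by blast
    show "y \<in> bad \<union> (\<Union>v\<in>?V. fib v)"
    proof (cases "(x * y * (x2 * y2))^2 = 1")
      case True
      with E show ?thesis by (auto simp: bad_def)
    next
      case False
      define e where "e = x * y * (x2 * y2)"
      have e: "e \<noteq> 1" "e \<noteq> - 1" using False by (auto simp: e_def)
      then have ne: "1 - e \<noteq> 0" "1 + e \<noteq> 0" by (auto simp: add_eq_0_iff)
      define x3 where "x3 = (x * x2 - a / (t1 * t2) * (y * y2)) / (1 - e)"
      define y3 where "y3 = (t2 * x2 * y + t1 * x * y2) / (1 + e)"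
      have "edwards a (t1 * t2) x3 y3"
        using edwards_add[OF E E2 t] e by (simp add: x3_def y3_def e_def)
      then have "x3 * y3 \<in> ?V" by blast
      have "(x * x2 - a / (t1 * t2) * (y * y2)) * (t2 * x2 * y + t1 * x * y2)
          = (x3 * (1 - e)) * (y3 * (1 + e))"
        using ne by (simp add: x3_def y3_def)
      also have "\<dots> = x3 * y3 * (1 - e^2)"
        by (simp add: algebra_simps power2_eq_square)
      finally have "y \<in> fib (x3 * y3)"
        using E unfolding fib_def e_def by blast
      with \<open>x3 * y3 \<in> ?V\<close> show ?thesis by blast
    qed
  qed
  ultimately show False
    using inf finite_subset by blast
qed

section \<open>The surface and the quartic curve in Edwards form\<close>

lemma rat_square_neq_2: "(r::rat)^2 \<noteq> 2"
proof
  assume r: "r^2 = 2"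
  obtain c d where cd: "quotient_of r = (c, d)" by force
  then have d: "d > 0" and cop: "coprime c d" and rc: "r = of_int c / of_int d"
    by (auto simp: quotient_of_denom_pos quotient_of_coprime quotient_of_div)
  have "(of_int (c^2) :: rat) = of_int (2 * d^2)"
    using r d by (simp add: rc field_simps)
  then have eq: "c^2 = 2 * d^2" by (simp only: of_int_eq_iff)
  then have "even (c^2)" by simp
  then have "even c" by simp
  then obtain e where e: "c = 2 * e" by (rule dvdE)
  with eq have "d^2 = 2 * e^2" by (simp add: power2_eq_square)
  then have "even (d^2)" by simp
  then have "even d" by simp
  with \<open>even c\<close> cop show False by (auto dest: coprime_common_divisor_int)
qed

text \<open>
  With $\theta^2=-b$ and $m = s^2+2s-1$ the point is
  $p+q\theta = (p_0+q_0\theta)\,\frac{s^2-1}{m}\,(1+x\theta)(1+y\theta/b)$.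
  The parameter $t$ of the curve is the one for which the norm of the last two factors,
  $1+x^2y^2+bx^2+y^2/b$, becomes proportional to $tx^2-\frac at y^2$ when the curve equation is
  inserted: $t+b$ and $\frac at+\frac1b$ are then $-\frac mn t$ and $\frac mn\cdot\frac at$
  with $n=s^2+1$.
\<close>

lemma edwards_point_gives_V3_point:
  fixes b s p0 q0 r0 x y :: rat
  assumes b: "b \<noteq> 0" and s: "s \<noteq> 0" "s \<noteq> 1" "s \<noteq> - 1"
    and N0: "p0^2 + b * q0^2 = (s^2 + 1) * (s^2 + 2 * s - 1) / (4 * s^2) * r0^2"
    and E: "edwards (- ((s^2 + 1)^2 / (4 * s * (s^2 - 1))))
      (- (b / 2) * ((s^2 + 1) / (s * (s + 1)))) x y"
  shows "\<exists>p q. (p, q, r0 * ((s^2 - 1) / (2 * s)) * (x * y)) \<in> V3 b s r0"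
proof -
  define n m k where "n = s^2 + 1" and "m = s^2 + 2 * s - 1" and "k = (s^2 - 1) / (2 * s)"
  define a t where "a = - (n^2 / (4 * s * (s^2 - 1)))" and "t = - (b / 2) * (n / (s * (s + 1)))"
  have "s^2 \<ge> 0" by simp
  then have n: "n \<noteq> 0" by (simp add: n_def add_nonneg_eq_0_iff)
  have "(s + 1)^2 = m + 2" by (simp add: m_def power2_eq_square algebra_simps)
  then have m: "m \<noteq> 0" using rat_square_neq_2[of "s + 1"] by auto
  have s1: "s - 1 \<noteq> 0" "s + 1 \<noteq> 0" using s by (auto simp: add_eq_0_iff)
  have s2: "s^2 - 1 = (s - 1) * (s + 1)" by (simp add: power2_eq_square algebra_simps)
  have t: "t \<noteq> 0" using b s s1 n by (simp add: t_def)
  have E: "edwards a t x y" using E by (simp add: a_def t_def n_def)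
  have at: "a / t = n / (2 * b * (s - 1))"
  proof -
    have "a = t * (n / (2 * b * (s - 1)))"
      unfolding a_def t_def s2 using b s s1
      by (simp add: divide_simps) (simp add: power2_eq_square)
    then show ?thesis using t by simp
  qed
  \<comment> \<open>\<open>e + f \<theta> = (1 + x \<theta>) (1 + y \<theta> / b)\<close>\<close>
  define e f where "e = 1 - x * y" and "f = x + y / b"
  define p q where "p = (s^2 - 1) / m * (p0 * e - b * q0 * f)"
    and "q = (s^2 - 1) / m * (p0 * f + q0 * e)"
  have "e^2 + b * f^2 = 1 + x^2 * y^2 + b * x^2 + y^2 / b"
    using b by (simp add: e_def f_def field_simps power2_eq_square)
  also have "\<dots> = (t + b) * x^2 + (a / t + 1 / b) * y^2"
    using E by (simp add: edwards_def algebra_simps)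
  also have "t + b = - (m / n) * t"
  proof -
    have nm: "2 * (s * (s + 1)) = n + m"
      by (simp add: m_def n_def algebra_simps power2_eq_square)
    then have "n + m \<noteq> 0" using s s1 by (metis mult_eq_0_iff zero_neq_numeral)
    moreover have "t = - (b * n / (n + m))" by (simp add: t_def flip: nm)
    ultimately show ?thesis using n by (simp add: field_simps)
  qed
  also have "a / t + 1 / b = m / n * (a / t)"
  proof -
    have "n + 2 * (s - 1) = m" by (simp add: m_def n_def)
    moreover have "a / t + 1 / b = (n + 2 * (s - 1)) / (2 * b * (s - 1))"
      unfolding at using b s1(1) by (simp add: add_divide_distrib del: right_diff_distrib_numeral)
    ultimately show ?thesis unfolding at using n by simp
  qed
  finally have ef: "e^2 + b * f^2 = - (m / n) * (t * x^2 - a / t * y^2)"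
    by (simp add: algebra_simps)
  have "p^2 + b * q^2
      = ((s^2 - 1) / m)^2 * ((p0 * e - b * q0 * f)^2 + b * (p0 * f + q0 * e)^2)"
    unfolding p_def q_def power_mult_distrib by (simp add: distrib_left mult.left_commute)
  also have "(p0 * e - b * q0 * f)^2 + b * (p0 * f + q0 * e)^2
      = (p0^2 + b * q0^2) * (e^2 + b * f^2)"
    by (simp add: algebra_simps power2_eq_square)
  finally have "p^2 + b * q^2 = ((s^2 - 1) / m)^2 * ((p0^2 + b * q0^2) * (e^2 + b * f^2))" .
  also have "\<dots> = - (k^2 * r0^2 * (t * x^2 - a / t * y^2))"
  proof -
    have "(d / m)^2 * (n * m / (4 * s^2) * r0^2 * (- (m / n) * W)) = - ((d / (2 * s))^2 * r0^2 * W)"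
      for d W :: rat
      using n m s by (simp add: field_simps power2_eq_square)
    then show ?thesis unfolding N0 ef n_def[symmetric] m_def[symmetric] k_def .
  qed
  finally have "(p^2 + b * q^2)^2 = k^4 * r0^4 * (t * x^2 - a / t * y^2)^2"
    by (simp add: power_mult_distrib flip: power_mult)
  also have "\<dots> = (r0 * k * (x * y))^4 + r0^2 * (k^2 * (2 - 4 * a)) * (r0 * k * (x * y))^2
      + r0^4 * k^4"
    unfolding edwards_jacobi_quartic[OF E t]
    by (simp add: algebra_simps power_mult_distrib power4_eq_xxxx power2_eq_square)
  also have "k^2 * (2 - 4 * a) = (s^2 - 1) * (s^4 + 2 * s^3 + 2 * s^2 - 2 * s + 1) / (4 * s^3)"
  proof -
    have "(d / (2 * s))^2 * (2 - 4 * - (n^2 / (4 * s * d))) = d * (2 * s * d + n^2) / (4 * s^3)"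
      if "d \<noteq> 0" for d
      using that s by (simp add: field_simps eval_nat_numeral)
    moreover have "s^2 - 1 \<noteq> 0" using s1 by (simp add: s2)
    moreover have "2 * s * (s^2 - 1) + n^2 = s^4 + 2 * s^3 + 2 * s^2 - 2 * s + 1"
      by (simp add: n_def algebra_simps eval_nat_numeral)
    ultimately show ?thesis unfolding k_def a_def by metis
  qed
  also have "k^4 = (s^2 - 1)^4 / (16 * s^4)"
    by (simp add: k_def power_divide power_mult_distrib)
  finally have "(p, q, r0 * k * (x * y)) \<in> V3 b s r0"
    by (simp add: V3_def)
  then show ?thesis unfolding k_def by blast
qed

text \<open>
  $P+Q\theta$ is $(p_0+q_0\theta)(1-u\theta)$; in $P$ and $Q$ the quadratic forms $g_1$ and
  $g_2$ have no mixed term, which leaves a curve $w^2=\mathrm{const}\cdot g_1g_2$ in even powers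
  of $P/Q$. Solving the equation of $E_{-b/2}$ for $x^2$ gives
  $x^2=-\frac{n^2}{bs}\cdot\frac{g_1}{g_2}$ with $n=s^2+1$, which is the square of
  $\frac{nw}{bsg_2}$. The exceptional value $y^2=-b/2$ belongs to $g_2(u)=0$, a point at infinity
  of $E_{-b/2}$.
\<close>

lemma C3_point_gives_edwards_point:
  fixes b s p0 q0 u w :: rat
  defines "P \<equiv> p0 + b * q0 * u" and "Q \<equiv> q0 - p0 * u"
  assumes b: "b \<noteq> 0" and s: "s \<noteq> 0" "s \<noteq> 1" "s \<noteq> - 1"
    and C: "(u, w) \<in> C3 b s p0 q0" and Q: "Q \<noteq> 0"
  defines "y \<equiv> (s^2 - 1) * P / ((s^2 + 1) * Q)"
  shows "y^2 = - (b / 2) \<or>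
     (\<exists>x. edwards (- ((s^2 + 1)^2 / (4 * s * (s^2 - 1)))) (- (b / 2)) x y)"
proof -
  define n d where "n = s^2 + 1" and "d = s^2 - 1"
  define G1 G2 where "G1 = 2 * s * b * Q^2 - d * P^2"
    and "G2 = 2 * d^2 * P^2 + n^2 * b * Q^2"
  have "s^2 \<ge> 0" by simp
  then have n: "n \<noteq> 0" by (simp add: n_def add_nonneg_eq_0_iff)
  have d: "d \<noteq> 0" using s by (simp add: d_def power2_eq_1_iff)
  have "g1 b s p0 q0 u = G1"
    by (simp add: g1_def G1_def d_def P_def Q_def algebra_simps power2_eq_square)
  moreover have "g2 b s p0 q0 u = G2"
    by (simp add: g2_def G2_def P_def Q_def n_def d_def algebra_simps power2_eq_square power4_eq_xxxx)
  ultimately have w: "w^2 = - b * s * G1 * G2"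
    using C by (simp add: C3_def)
  have y: "y = d * P / (n * Q)" by (simp add: y_def n_def d_def)
  show ?thesis
  proof (cases "G2 = 0")
    case True
    then have "d^2 * P^2 = - (b / 2) * (n^2 * Q^2)"
      unfolding G2_def by (simp add: mult_ac add_eq_0_iff)
    then have "y^2 = - (b / 2)"
      using n Q by (simp add: y power_divide power_mult_distrib)
    then show ?thesis ..
  next
    case False
    define x where "x = n * w / (b * s * G2)"
    have "x^2 = n^2 * (- b * s * G1 * G2) / (b * s * G2)^2"
      unfolding w[symmetric] by (simp add: x_def power_divide power_mult_distrib)
    also have "\<dots> = - (n^2 * G1 / (b * s * G2))"
      using False b s by (simp add: field_simps power2_eq_square)
    finally have x2: "x^2 = - (n^2 * G1 / (b * s * G2))" .
    have "y^2 + b / 2 = G2 / (2 * (n * Q)^2)"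
      using n Q by (simp add: y G2_def power_divide power_mult_distrib field_simps)
    then have "x^2 * (y^2 + b / 2) = - (G1 / (2 * b * s * Q^2))"
      using False n by (simp add: x2 power_mult_distrib field_simps)
    also have "\<dots> = n^2 / (2 * b * s * d) * y^2 - 1"
      using b s d n Q by (simp add: y G1_def power_divide power_mult_distrib field_simps power2_eq_square)
    finally have "edwards (- (n^2 / (4 * s * d))) (- (b / 2)) x y"
      using b by (simp add: edwards_def field_simps)
    then show ?thesis unfolding n_def d_def by blast
  qed
qed

section \<open>Infinitely many $X$-coordinates\<close>

theorem theorem3p8:
  fixes b :: int and s p0 q0 r0 :: rat
  assumes "b \<noteq> 0"
    and "irreducible (norm_form (of_int b))"
    and "s \<noteq> 0" and "s \<noteq> 1" and "s \<noteq> -1"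
    and "r0 \<noteq> 0"
    and "p0^2 + of_int b * q0^2 = (s^2 + 1) * (s^2 + 2 * s - 1) / (4 * s^2) * r0^2"
    and "infinite (C3 (of_int b) s p0 q0)"
  shows "infinite ((\<lambda>(p, q, X). X) ` V3 (of_int b) s r0)"
proof -
  define c :: rat where "c = of_int b"
  define n m where "n = s^2 + 1" and "m = s^2 + 2 * s - 1"
  define a where "a = - (n^2 / (4 * s * (s^2 - 1)))"
  define t1 t2 x2 y2 where "t1 = - (c / 2)" and "t2 = n / (s * (s + 1))"
    and "x2 = s / (s - 1)" and "y2 = 2 / (s + 1)"
  have c: "c \<noteq> 0" using assms(1) by (simp add: c_def)
  have "s^2 \<ge> 0" by simp
  then have n: "n \<noteq> 0" by (simp add: n_def add_nonneg_eq_0_iff)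
  have m2: "(s + 1)^2 = m + 2" by (simp add: m_def power2_eq_square algebra_simps)
  then have m: "m \<noteq> 0" using rat_square_neq_2[of "s + 1"] by auto
  have s1: "s - 1 \<noteq> 0" "s + 1 \<noteq> 0" using assms by (auto simp: add_eq_0_iff)
  have s2: "s^2 - 1 = (s - 1) * (s + 1)" by (simp add: power2_eq_square algebra_simps)
  \<comment> \<open>This makes \<open>u \<mapsto> P / Q\<close> an invertible fractional linear map: its determinant is
    \<open>p0^2 + c * q0^2\<close> up to sign.\<close>
  have N0: "p0^2 + c * q0^2 \<noteq> 0"
    using assms(3,6,7) n m by (simp add: c_def n_def m_def)
  define y where "y u = (s^2 - 1) * (p0 + c * q0 * u) / (n * (q0 - p0 * u))" for u
  define U where "U = {u \<in> fst ` C3 c s p0 q0. q0 - p0 * u \<noteq> 0}"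
  have "infinite (fst ` C3 c s p0 q0)"
  proof
    assume "finite (fst ` C3 c s p0 q0)"
    moreover have "finite {w. (u, w) \<in> C3 c s p0 q0}" for u
      by (simp add: C3_def finite_square_roots)
    ultimately have "finite (Sigma (fst ` C3 c s p0 q0) (\<lambda>u. {w. (u, w) \<in> C3 c s p0 q0}))"
      by blast
    moreover have "C3 c s p0 q0 \<subseteq> Sigma (fst ` C3 c s p0 q0) (\<lambda>u. {w. (u, w) \<in> C3 c s p0 q0})"
      by force
    ultimately show False
      using assms(8) finite_subset by (auto simp: c_def)
  qed
  moreover have "finite {u. q0 - p0 * u = 0}"
  proof -
    have "[:q0, - p0:] \<noteq> 0" using N0 by auto
    from poly_roots_finite[OF this] show ?thesis by (simp add: mult.commute)
  qed
  moreover have "fst ` C3 c s p0 q0 \<subseteq> U \<union> {u. q0 - p0 * u = 0}"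
    by (auto simp: U_def)
  ultimately have U: "infinite U"
    using finite_subset by blast
  have "inj_on y U"
  proof (rule inj_onI)
    fix u v assume "u \<in> U" "v \<in> U" "y u = y v"
    then have "(s^2 - 1) * n * ((p0 + c * q0 * u) * (q0 - p0 * v))
        = (s^2 - 1) * n * ((p0 + c * q0 * v) * (q0 - p0 * u))"
      using n by (simp add: U_def y_def frac_eq_eq mult_ac)
    then have "(p0 + c * q0 * u) * (q0 - p0 * v) = (p0 + c * q0 * v) * (q0 - p0 * u)"
      using n s1 by (simp add: s2)
    then have "(u - v) * (p0^2 + c * q0^2) = 0"
      by (simp add: algebra_simps power2_eq_square)
    with N0 show "u = v" by simp
  qed
  with U have "infinite (y ` U)" by (simp add: finite_image_iff)
  moreover have "y ` U \<subseteq> {z. z^2 = t1} \<union> {z. \<exists>x. edwards a t1 x z}"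
    using C3_point_gives_edwards_point[OF c assms(3,4)] assms(5)
    by (fastforce simp: U_def y_def a_def n_def t1_def)
  moreover have "finite {z. z^2 = t1}"
    by (rule finite_square_roots)
  ultimately have inf: "infinite {z. \<exists>x. edwards a t1 x z}"
    using finite_subset by blast
  have "infinite {x * z | x z. edwards a (t1 * t2) x z}"
  proof (rule infinite_edwards_translate[OF _ _ _ _ _ _ _ inf])
    show "a \<noteq> 0" using n s1 assms(3) by (simp add: a_def s2)
    have "a - 1 = - (m^2 / (4 * s * (s^2 - 1)))"
    proof -
      have "m^2 = n^2 + 4 * s * (s^2 - 1)"
        by (simp add: n_def m_def algebra_simps eval_nat_numeral)
      moreover have "4 * s * (s^2 - 1) \<noteq> 0" using assms(3) s1 by (simp add: s2)
      ultimately show ?thesis by (simp add: a_def add_divide_distrib)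
    qed
    then show "a \<noteq> 1" using m s1 assms(3) by (auto simp: s2)
    show "t1 \<noteq> 0" "t2 \<noteq> 0" using c n s1 assms(3) by (auto simp: t1_def t2_def)
    show "edwards a t2 x2 y2"
    proof -
      have "a = t2 * - (n / (4 * (s - 1)))"
        unfolding a_def t2_def s2 using assms(3) s1
        by (simp add: divide_simps) (simp add: power2_eq_square)
      then have "a / t2 = - (n / (4 * (s - 1)))" using \<open>t2 \<noteq> 0\<close> by simp
      then have "a / t2 * y2^2 = - (n * (s - 1) / ((s - 1) * (s + 1))^2)"
        using s1 by (simp only: y2_def) (simp add: divide_simps, simp add: power2_eq_square)
      moreover have "t2 * x2^2 = n * (s * (s + 1)) / ((s - 1) * (s + 1))^2"
        using s1 assms(3) by (simp add: t2_def x2_def divide_simps) (simp add: power2_eq_square)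
      ultimately have "t2 * x2^2 + a / t2 * y2^2
          = (n * (s * (s + 1)) - n * (s - 1)) / ((s - 1) * (s + 1))^2"
        by (simp add: diff_divide_distrib)
      also have "n * (s * (s + 1)) - n * (s - 1) = ((s - 1) * (s + 1))^2 + 4 * s^2"
        by (simp add: n_def algebra_simps power2_eq_square)
      also have "(((s - 1) * (s + 1))^2 + 4 * s^2) / ((s - 1) * (s + 1))^2 = 1 + x2^2 * y2^2"
        using s1 by (simp add: x2_def y2_def add_divide_distrib power_divide power_mult_distrib)
      finally show ?thesis unfolding edwards_def .
    qed
    show "x2 * y2 \<noteq> 0" using assms(3) s1 by (simp add: x2_def y2_def)
    have "(x2 * y2)^2 - 1 = - (m * ((s - 1)^2 - 2) / (s^2 - 1)^2)"
    proof -
      have "(x2 * y2)^2 - 1 = ((2 * s)^2 - (s^2 - 1)^2) / (s^2 - 1)^2"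
        using s1 by (simp add: x2_def y2_def s2 diff_divide_distrib power_divide power_mult_distrib)
      also have "(2 * s)^2 - (s^2 - 1)^2 = - (m * ((s - 1)^2 - 2))"
        by (simp add: m_def algebra_simps eval_nat_numeral)
      finally show ?thesis by simp
    qed
    then show "(x2 * y2)^2 \<noteq> 1"
      using m s1 rat_square_neq_2[of "s - 1"] by (auto simp: s2)
  qed
  moreover have "inj_on ((*) (r0 * ((s^2 - 1) / (2 * s)))) S" for S
    using assms(3,6) s1 by (intro inj_onI) (simp add: s2)
  ultimately have "infinite ((*) (r0 * ((s^2 - 1) / (2 * s)))
      ` {x * z | x z. edwards a (t1 * t2) x z})"
    using finite_imageD by blast
  moreover have "(*) (r0 * ((s^2 - 1) / (2 * s))) ` {x * z | x z. edwards a (t1 * t2) x z}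
      \<subseteq> (\<lambda>(p, q, X). X) ` V3 c s r0"
  proof safe
    fix x z assume "edwards a (t1 * t2) x z"
    then obtain p q where "(p, q, r0 * ((s^2 - 1) / (2 * s)) * (x * z)) \<in> V3 c s r0"
      using edwards_point_gives_V3_point[OF c assms(3-5) assms(7)[folded c_def], of x z]
      by (auto simp: a_def t1_def t2_def n_def)
    then show "r0 * ((s^2 - 1) / (2 * s)) * (x * z) \<in> (\<lambda>(p, q, X). X) ` V3 c s r0"
      by (rule rev_image_eqI) simp
  qed
  ultimately show ?thesis
    unfolding c_def using finite_subset by blast
qed

end
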